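(* Let $u_0,v_0\in\mathcal{H}$ and let $x:[t_0,+\infty[\to\mathcal{H}$ be the unique global solution of the system (DS) described in the context. Suppose that there exists $K>0$ such that $\frac{q(1-q)}{t^2}\le\epsilon(t)\le\frac{K}{t^q}$ for all $t$ large enough, and that $\int_{t_0}^{+\infty}t^q\epsilon(t)dt<+\infty$. Then: (a) $\int_{t_0}^{+\infty}t^q\|\dot{x}(t)\|^2dt<+\infty$ and $\int_{t_0}^{+\infty}t^q\big(g(x(t)+\beta(t)\dot{x}(t))-\min g\big)dt<+\infty$; (b) $\int_{t_0}^{+\infty}t^{2q}\|\nabla g(x(t)+\beta(t)\dot{x}(t))\|^2dt<+\infty$ if $\gamma>0$, $\beta\in\mathbb{R}$, and $\int_{t_0}^{+\infty}t^{q}\|\nabla g(x(t)+\beta(t)\dot{x}(t))\|^2dt<+\infty$ if $\gamma=0$, $\beta>0$; (c) as $t\to+\infty$, $\|\dot{x}(t)\|=o\left(\frac{1}{t^q}\right)$, $g(x(t)+\beta(t)\dot{x}(t))-\min g=o\left(\frac{1}{t^{2q}}\right)$ and $\|x(t)\|=o\left(\frac{1}{t^q\sqrt{\epsilon(t)}}\right)$.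
   Context: $\mathcal{H}$ is a real Hilbert space with scalar product $\langle\cdot,\cdot\rangle$ and norm $\|\cdot\|$. The function $g:\mathcal{H}\to\mathbb{R}$ is convex and Fréchet differentiable, $\nabla g$ is Lipschitz continuous on bounded sets, and $\operatorname{argmin} g\neq\emptyset$. Parameters: $t_0>0$, $\alpha>0$, $0<q<1$, and either ($\gamma>0$ and $\beta\in\mathbb{R}$) or ($\gamma=0$ and $\beta>0$); if $\beta<0$ then also $t_0>\left|\frac{\beta}{\gamma}\right|^{1/q}$. Notation: $\beta(t)=\gamma+\frac{\beta}{t^q}$ (so $\beta(t)>0$ on $[t_0,+\infty[$). The function $\epsilon:[t_0,+\infty[\to\mathbb{R}_+$ is non-increasing, of class $C^1$, with $\lim_{t\to+\infty}\epsilon(t)=0$. The system (DS) is $$\ddot{x}(t)+\frac{\alpha}{t^q}\dot{x}(t)+\nabla g\big(x(t)+\beta(t)\dot{x}(t)\big)+\epsilon(t)x(t)=0,\qquad x(t_0)=u_0,\ \dot{x}(t_0)=v_0;$$ it has a unique global solution on $[t_0,+\infty[$ for all $u_0,v_0\in\mathcal{H}$. *)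

theory Defs
  imports "HOL-Analysis.Analysis" "HOL-Library.Landau_Symbols"
begin

(* Only meaningful where g is Frechet differentiable on a complete inner product space:
   there the Riesz theorem gives existence (and uniqueness) of the representing vector. *)
definition gradient :: "('a::real_inner \<Rightarrow> real) \<Rightarrow> 'a \<Rightarrow> 'a" where
  "gradient g y = (THE d. GDERIV g y :> d)"

definition C1_on_halfline :: "real \<Rightarrow> (real \<Rightarrow> real) \<Rightarrow> bool" where
  "C1_on_halfline t0 f \<longleftrightarrow>
     (\<exists>f'. (\<forall>t\<ge>t0. (f has_real_derivative f' t) (at t within {t0..})) \<and> continuous_on {t0..} f')"

definition beta_fun :: "real \<Rightarrow> real \<Rightarrow> real \<Rightarrow> real \<Rightarrow> real" where
  "beta_fun \<gamma> \<beta> q t = \<gamma> + \<beta> / t powr q"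

(* Values of x, v, w and \<epsilon> outside {t0..} are irrelevant; derivatives at t0 are one-sided.
   v and w are the first and second derivatives of x. *)
definition DS_solution ::
  "('a::real_inner \<Rightarrow> real) \<Rightarrow> real \<Rightarrow> real \<Rightarrow> real \<Rightarrow> real \<Rightarrow> real \<Rightarrow> (real \<Rightarrow> real) \<Rightarrow>
   'a \<Rightarrow> 'a \<Rightarrow> (real \<Rightarrow> 'a) \<Rightarrow> (real \<Rightarrow> 'a) \<Rightarrow> (real \<Rightarrow> 'a) \<Rightarrow> bool" where
  "DS_solution g t0 \<alpha> q \<gamma> \<beta> \<epsilon> u0 v0 x v w \<longleftrightarrow>
     (\<forall>t\<ge>t0. (x has_vector_derivative v t) (at t within {t0..})) \<and>
     (\<forall>t\<ge>t0. (v has_vector_derivative w t) (at t within {t0..})) \<and>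
     (\<forall>t\<ge>t0. w t + (\<alpha> / t powr q) *\<^sub>R v t
         + gradient g (x t + beta_fun \<gamma> \<beta> q t *\<^sub>R v t) + \<epsilon> t *\<^sub>R x t = 0) \<and>
     x t0 = u0 \<and> v t0 = v0"

end

theory Submission
  imports Defs
begin

text \<open>
  Write \<open>p = t\<^sup>q\<close>, \<open>y = x + \<beta>(t) x'\<close>, let \<open>z\<close> be a minimizer and put
  \<open>W = \<parallel>x'\<parallel>\<^sup>2/2 + (g y - min g) + \<epsilon> \<parallel>x\<parallel>\<^sup>2/2\<close>. For large \<open>t\<close> the anchored energy
  \<open>E = p\<^sup>2 W + \<alpha>/4 p \<langle>x - z, x'\<rangle> + \<alpha>/4 (\<alpha> - q p/t) \<parallel>x - z\<parallel>\<^sup>2/2\<close> dominates a multiple of \<open>\<parallel>x - z\<parallel>\<^sup>2\<close>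
  and satisfies \<open>E' + \<alpha>/8 p W + \<beta>(t)/4 p\<^sup>2 \<parallel>\<nabla>g y\<parallel>\<^sup>2 \<le> C p \<epsilon> (E + 1)\<close>. As \<open>p \<epsilon>\<close> is integrable, Gronwall's
  lemma bounds \<open>E\<close>, and integrating gives (a) and (b). Moreover \<open>(p\<^sup>2 W)'\<close> is bounded above by an
  integrable function, so \<open>p\<^sup>2 W\<close> converges; its limit is 0 because \<open>p W = p\<^sup>2 W / t\<^sup>q\<close> is integrable and
  \<open>q < 1\<close>. This is (c).
\<close>

section \<open>Riesz representation and gradients\<close>

text \<open>The representing vector is the minimizer of \<open>\<parallel>u\<parallel>\<^sup>2 - 2 f u\<close>.\<close>

lemma riesz_representation:
  fixes f :: "'a::{real_inner, complete_space} \<Rightarrow> real"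
  assumes "bounded_linear f"
  shows "\<exists>d. \<forall>h. f h = h \<bullet> d"
proof -
  interpret bounded_linear f by fact
  define \<phi> where "\<phi> u = u \<bullet> u - 2 * f u" for u
  obtain K where K: "\<And>u. norm (f u) \<le> norm u * K"
    using bounded by blast
  have below: "- K\<^sup>2 \<le> \<phi> u" for u
  proof -
    have "\<phi> u \<ge> (norm u)\<^sup>2 - 2 * (norm u * K)"
      using K[of u] unfolding \<phi>_def power2_norm_eq_inner by auto
    moreover have "(norm u)\<^sup>2 - 2 * (norm u * K) + K\<^sup>2 \<ge> 0"
      using zero_le_power2[of "norm u - K"] by (simp add: power2_diff algebra_simps)
    ultimately show ?thesis by linarith
  qed
  define m where "m = Inf (range \<phi>)"
  have bdd: "bdd_below (range \<phi>)"
    using below by (auto intro!: bdd_belowI)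
  have m_le: "m \<le> \<phi> u" for u
    unfolding m_def by (rule cInf_lower[OF _ bdd]) auto
  have "\<exists>u. \<phi> u < m + 1 / (real n + 1)" for n
    using cInf_lessD[of "range \<phi>" "m + 1 / (real n + 1)"] unfolding m_def by auto
  then obtain X where X: "\<And>n. \<phi> (X n) < m + 1 / (real n + 1)" by metis
  \<comment> \<open>The linear part cancels at the midpoint, which leaves the parallelogram law.
    With \<open>m_le\<close> at the midpoint this makes the minimizing sequence \<open>X\<close>
    Cauchy.\<close>
  have parallelogram: "\<phi> u + \<phi> v - 2 * \<phi> ((1/2) *\<^sub>R (u + v)) = (norm (u - v))\<^sup>2 / 2" for u v
    unfolding \<phi>_def power2_norm_eq_inner
    by (simp add: inner_simps add scaleR inner_commute field_simps)
  have "Cauchy X"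
  proof (rule CauchyI)
    fix e :: real assume "0 < e"
    define N where "N = nat \<lceil>4 / e\<^sup>2\<rceil>"
    have N: "4 / e\<^sup>2 < real N + 1" unfolding N_def by linarith
    have "norm (X i - X j) < e" if "i \<ge> N" "j \<ge> N" for i j
    proof -
      have "1 / (real i + 1) \<le> 1 / (real N + 1)" "1 / (real j + 1) \<le> 1 / (real N + 1)"
        using that by (auto intro!: divide_left_mono)
      then have "(norm (X i - X j))\<^sup>2 < 4 * (1 / (real N + 1))"
        using parallelogram[of "X i" "X j"] X[of i] X[of j] m_le[of "(1/2) *\<^sub>R (X i + X j)"]
        by linarith
      also have "\<dots> < e\<^sup>2" using N \<open>0 < e\<close> by (simp add: field_simps)
      finally show ?thesis using \<open>0 < e\<close> by (simp add: power_less_imp_less_base)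
    qed
    then show "\<exists>M. \<forall>i\<ge>M. \<forall>j\<ge>M. norm (X i - X j) < e" by blast
  qed
  then obtain d where d: "X \<longlonglongrightarrow> d"
    using Cauchy_convergent_iff convergent_def by blast
  have "(\<lambda>n. \<phi> (X n)) \<longlonglongrightarrow> \<phi> d"
    unfolding \<phi>_def by (intro tendsto_intros d tendsto)
  moreover have "(\<lambda>n. m + 1 / (real n + 1)) \<longlonglongrightarrow> m + 0"
    using LIMSEQ_inverse_real_of_nat
    by (intro tendsto_intros) (simp add: inverse_eq_divide add.commute)
  ultimately have "\<phi> d \<le> m + 0"
    using X by (intro LIMSEQ_le) (auto intro: less_imp_le)
  then have min: "\<phi> d \<le> \<phi> u" for u using m_le[of u] by simp
  have "f h = h \<bullet> d" for h
  proof -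
    define c where "c = h \<bullet> d - f h"
    have quadratic: "0 \<le> 2 * s * c + s\<^sup>2 * (h \<bullet> h)" for s
      using min[of "d + s *\<^sub>R h"] unfolding \<phi>_def c_def
      by (simp add: inner_simps add scaleR inner_commute power2_eq_square algebra_simps)
    \<comment> \<open>Stationarity in direction \<open>h\<close>, by one explicit step instead of a
      limit. The added 1 keeps the denominator positive at \<open>h = 0\<close>, and inserting this
      \<open>s\<close> forces \<open>s\<^sup>2 \<le> 0\<close>.\<close>
    define s where "s = - c / (h \<bullet> h + 1)"
    have "h \<bullet> h + 1 > 0" using inner_ge_zero[of h] by linarith
    then have c: "c = - s * (h \<bullet> h + 1)" by (simp add: s_def)
    have "0 \<le> - (s\<^sup>2 * (h \<bullet> h)) - 2 * s\<^sup>2"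
      using quadratic[of s] unfolding c
      by (simp add: algebra_simps power2_eq_square)
    moreover have "0 \<le> s\<^sup>2 * (h \<bullet> h)" by simp
    ultimately have "s\<^sup>2 \<le> 0" by linarith
    then have "c = 0" using c by simp
    then show "f h = h \<bullet> d" by (simp add: c_def)
  qed
  then show ?thesis by blast
qed

lemma GDERIV_unique:
  assumes "GDERIV g y :> d" "GDERIV g y :> d'"
  shows "d = d'"
proof -
  have "(\<lambda>h. h \<bullet> d) = (\<lambda>h. h \<bullet> d')"
    using assms unfolding gderiv_def by (rule has_derivative_unique)
  then have "(d - d') \<bullet> (d - d') = 0"
    by (metis inner_diff_right right_minus_eq)
  then show ?thesis by simp
qed

text \<open>The description in \<open>gradient\<close> is legitimate because Riesz supplies a
  representing vector and \<open>GDERIV_unique\<close> excludes a second one. Completeness of the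
  space enters here.\<close>

lemma GDERIV_gradient:
  fixes g :: "'a::{real_inner, complete_space} \<Rightarrow> real"
  assumes "g differentiable (at y)"
  shows "GDERIV g y :> gradient g y"
proof -
  obtain f where f: "(g has_derivative f) (at y)"
    using assms unfolding differentiable_def by blast
  obtain d where "\<forall>h. f h = h \<bullet> d"
    using riesz_representation[OF has_derivative_bounded_linear[OF f]] by blast
  then have "f = (\<lambda>h. h \<bullet> d)" by (intro ext) simp
  with f have "GDERIV g y :> d" by (simp add: gderiv_def)
  then show ?thesis unfolding gradient_def
    by (rule theI) (use GDERIV_unique \<open>GDERIV g y :> d\<close> in blast)
qed

lemma GDERIV_compose_vector:
  assumes "GDERIV g (y t) :> d" "(y has_vector_derivative y') (at t)"
  shows "((\<lambda>t. g (y t)) has_real_derivative d \<bullet> y') (at t)"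
  using has_derivative_compose[OF assms(2)[unfolded has_vector_derivative_def] assms(1)[unfolded gderiv_def]]
  by (simp add: has_field_derivative_def inner_commute mult_commute_abs)

lemma has_real_derivative_inner:
  assumes "(a has_vector_derivative a') (at t)" "(b has_vector_derivative b') (at t)"
  shows "((\<lambda>t. a t \<bullet> b t) has_real_derivative a t \<bullet> b' + a' \<bullet> b t) (at t)"
  using bounded_bilinear.has_vector_derivative[OF bounded_bilinear_inner assms]
  by (simp add: has_real_derivative_iff_has_vector_derivative)

lemma has_real_derivative_norm_square:
  assumes "(a has_vector_derivative a') (at t)"
  shows "((\<lambda>t. (norm (a t))\<^sup>2) has_real_derivative 2 * (a t \<bullet> a')) (at t)"
  using has_real_derivative_inner[OF assms assms]
  by (simp add: power2_norm_eq_inner inner_commute)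

text \<open>On the line through \<open>y\<close> and \<open>z\<close> this is the fact that a convex
  function of one real variable lies above its tangent at 0, read off at 1.\<close>

lemma convex_gradient_inequality:
  assumes "convex_on UNIV g" "GDERIV g y :> d"
  shows "g y - g z \<le> d \<bullet> (y - z)"
proof -
  define \<psi> where "\<psi> s = g (y + s *\<^sub>R (z - y))" for s :: real
  have "convex_on UNIV \<psi>"
  proof (rule convex_onI)
    fix t a b :: real assume "0 < t" "t < 1"
    have "y + ((1 - t) *\<^sub>R a + t *\<^sub>R b) *\<^sub>R (z - y)
        = (1 - t) *\<^sub>R (y + a *\<^sub>R (z - y)) + t *\<^sub>R (y + b *\<^sub>R (z - y))"
      by (simp add: algebra_simps)
    then show "\<psi> ((1 - t) *\<^sub>R a + t *\<^sub>R b) \<le> (1 - t) * \<psi> a + t * \<psi> b"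
      unfolding \<psi>_def using convex_onD[OF assms(1)] \<open>0 < t\<close> \<open>t < 1\<close> by simp
  qed auto
  moreover have "(\<psi> has_real_derivative d \<bullet> (z - y)) (at 0)"
    unfolding \<psi>_def using assms(2)
    by (intro GDERIV_compose_vector) (auto intro!: derivative_eq_intros)
  ultimately have "(d \<bullet> (z - y)) * (1 - 0) \<le> \<psi> 1 - \<psi> 0"
    by (intro convex_on_imp_above_tangent[of UNIV]) auto
  then show ?thesis by (simp add: \<psi>_def inner_diff_right)
qed

text \<open>Continuity is local, so a Lipschitz constant on each unit ball is enough. It makes the
  gradient along the trajectory continuous in time.\<close>

lemma continuous_gradient:
  assumes "\<forall>B. bounded B \<longrightarrow> (\<exists>L. L-lipschitz_on B (gradient g))"
  shows "continuous_on UNIV (gradient g)"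
proof -
  have "isCont (gradient g) y" for y
  proof -
    obtain L where "L-lipschitz_on (ball y 1) (gradient g)"
      using assms bounded_ball by blast
    then have "continuous_on (ball y 1) (gradient g)"
      by (rule lipschitz_on_continuous_on)
    then show ?thesis by (simp add: continuous_on_eq_continuous_at)
  qed
  then show ?thesis by (simp add: continuous_at_imp_continuous_on)
qed

section \<open>Differential inequalities on half-lines\<close>

lemma has_real_derivative_integral:
  fixes f :: "real \<Rightarrow> real"
  assumes "continuous_on {a..} f" "a < t"
  shows "((\<lambda>x. integral {a..x} f) has_real_derivative f t) (at t)"
proof -
  have "((\<lambda>x. integral {a..x} f) has_real_derivative f t) (at t within {a..t+1})"
    using assms by (intro integral_has_real_derivative) (auto elim: continuous_on_subset)
  then show ?thesis using assms(2) by (simp add: at_within_Icc_at)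
qed

lemma set_integrable_Icc_continuous:
  fixes f :: "real \<Rightarrow> real"
  assumes "continuous_on {a..} f"
  shows "set_integrable lborel {a..b} f"
  by (rule borel_integrable_atLeastAtMost'[OF continuous_on_subset[OF assms]]) auto

text \<open>A bridge between two integrals: derivatives come from the gauge integral over
  \<open>{a..t}\<close>, integrability hypotheses from the Lebesgue integral over the half-line. For
  \<open>t < a\<close> the left side is 0, so \<open>t\<close> may be arbitrary.\<close>

lemma integral_le_set_lebesgue_integral:
  fixes f :: "real \<Rightarrow> real"
  assumes "continuous_on {a..} f" "\<And>t. t \<ge> a \<Longrightarrow> 0 \<le> f t" "set_integrable lborel {a..} f"
  shows "integral {a..t} f \<le> (LINT s:{a..}|lborel. f s)"
proof -
  have "integral {a..t} f = (LINT s:{a..t}|lborel. f s)"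
    using set_borel_integral_eq_integral(2)[OF set_integrable_Icc_continuous[OF assms(1)]] by simp
  also have "\<dots> \<le> (LINT s:{a..}|lborel. f s)"
    unfolding set_lebesgue_integral_def
    using assms set_integrable_Icc_continuous[OF assms(1), of t]
    by (intro integral_mono) (auto simp: set_integrable_def split: split_indicator)
  finally show ?thesis .
qed

text \<open>The bridge in the other direction, by monotone convergence along the intervals
  \<open>{a..a + real n}\<close>.\<close>

lemma set_integrable_halfline_bounded:
  fixes f :: "real \<Rightarrow> real"
  assumes cont: "continuous_on {a..} f" and nn: "\<And>t. t \<ge> a \<Longrightarrow> 0 \<le> f t"
    and bound: "\<And>t. t \<ge> T \<Longrightarrow> integral {a..t} f \<le> M"
  shows "set_integrable lborel {a..} f"
proof -
  define F where "F n = (\<lambda>t. indicator {a..a + real n} t *\<^sub>R f t)" for n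
  have int: "integrable lborel (F n)" for n
    using set_integrable_Icc_continuous[OF cont] unfolding F_def set_integrable_def by auto
  have mono: "F m t \<le> F n t" if "m \<le> n" for m n t
    using that nn by (auto simp: F_def split: split_indicator)
  have val: "integral\<^sup>L lborel (F n) = integral {a..a + real n} f" for n
    using set_borel_integral_eq_integral(2)[OF set_integrable_Icc_continuous[OF cont]]
    unfolding F_def set_lebesgue_integral_def by simp
  have inc: "incseq (\<lambda>n. integral\<^sup>L lborel (F n))"
    unfolding incseq_def using int mono by (intro allI impI integral_mono) auto
  have "integral\<^sup>L lborel (F n) \<le> M" for n
  proof -
    \<comment> \<open>The bound is available only from \<open>T\<close> on. The index
      \<open>N\<close> reaches past \<open>T\<close>, and monotonicity in the index carries the
      bound back to \<open>n\<close>.\<close>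
    define N where "N = max n (nat \<lceil>T - a\<rceil>)"
    have N: "T \<le> a + real N" "n \<le> N" unfolding N_def by linarith+
    then show ?thesis using incseqD[OF inc N(2)] bound[OF N(1)] val[of N] by simp
  qed
  then obtain L where "(\<lambda>n. integral\<^sup>L lborel (F n)) \<longlonglongrightarrow> L"
    using incseq_convergent[OF inc] by blast
  then show ?thesis unfolding set_integrable_def
  proof (rule integrable_monotone_convergence[rotated 3])
    show "AE t in lborel. (\<lambda>n. F n t) \<longlonglongrightarrow> indicator {a..} t *\<^sub>R f t"
    proof (rule AE_I2, rule tendsto_eventually)
      fix t :: real
      show "\<forall>\<^sub>F n in sequentially. F n t = indicator {a..} t *\<^sub>R f t"
        by (rule eventually_sequentiallyI[of "nat \<lceil>t - a\<rceil>"])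
           (auto simp: F_def nat_le_iff ceiling_le_iff split: split_indicator)
    qed
    show "(\<lambda>t. indicator {a..} t *\<^sub>R f t) \<in> borel_measurable lborel"
      using borel_measurable_continuous_on_indicator[OF _ cont] by simp
  qed (use int mono in \<open>auto simp: incseq_def\<close>)
qed

lemma antimono_bounded_tendsto:
  fixes H :: "real \<Rightarrow> real"
  assumes "\<And>s t. T \<le> s \<Longrightarrow> s \<le> t \<Longrightarrow> H t \<le> H s" "\<And>t. T \<le> t \<Longrightarrow> L \<le> H t"
  shows "\<exists>l. (H \<longlongrightarrow> l) at_top"
proof -
  have bdd: "bdd_below (H ` {T..})" using assms(2) by (auto intro!: bdd_belowI)
  have "(H \<longlongrightarrow> Inf (H ` {T..})) at_top"
  proof (rule decreasing_tendsto)
    show "\<forall>\<^sub>F t in at_top. Inf (H ` {T..}) \<le> H t"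
      using eventually_ge_at_top[of T] by eventually_elim (auto intro: cInf_lower[OF _ bdd])
    fix u assume "Inf (H ` {T..}) < u"
    then obtain s where s: "T \<le> s" "H s < u" using cInf_lessD[of "H ` {T..}" u] by auto
    show "\<forall>\<^sub>F t in at_top. H t < u"
      using eventually_ge_at_top[of s]
    proof eventually_elim
      fix t assume "s \<le> t"
      then show "H t < u" using assms(1)[of s t] s by linarith
    qed
  qed
  then show ?thesis by blast
qed

lemma DERIV_nonpos_imp_antimono_halfline:
  fixes H :: "real \<Rightarrow> real"
  assumes "\<And>t. t \<ge> T \<Longrightarrow> (H has_real_derivative H' t) (at t)" "\<And>t. t \<ge> T \<Longrightarrow> H' t \<le> 0"
    and "T \<le> s" "s \<le> t"
  shows "H t \<le> H s"
  using assms by (intro DERIV_nonpos_imp_nonincreasing[of s t H]) (auto intro: order_trans)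

text \<open>The integrating factor \<open>exp (- I t)\<close> makes
  \<open>(E t + 1) * exp (- I t)\<close> non-increasing, and \<open>I\<close> is bounded by the full
  integral of \<open>k\<close>. The shift by 1 absorbs the source term.\<close>

lemma gronwall_halfline:
  fixes E k :: "real \<Rightarrow> real"
  assumes k: "continuous_on {a..} k" "\<And>t. t \<ge> a \<Longrightarrow> 0 \<le> k t" "set_integrable lborel {a..} k"
    and T: "a < T"
    and E: "\<And>t. t \<ge> T \<Longrightarrow> (E has_real_derivative E' t) (at t)"
    and le: "\<And>t. t \<ge> T \<Longrightarrow> E' t \<le> k t * (E t + 1)"
    and nn: "\<And>t. t \<ge> T \<Longrightarrow> 0 \<le> E t"
  shows "\<exists>M. \<forall>t\<ge>T. E t \<le> M"
proof -
  define I where "I t = integral {a..t} k" for t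
  define S where "S = (LINT s:{a..}|lborel. k s)"
  have I': "(I has_real_derivative k t) (at t)" if "t \<ge> T" for t
    unfolding I_def using has_real_derivative_integral[OF k(1)] that T by simp
  define H where "H t = (E t + 1) * exp (- I t)" for t
  have "H t \<le> H T" if "t \<ge> T" for t
  proof (rule DERIV_nonpos_imp_antimono_halfline[of T H "\<lambda>s. (E' s - k s * (E s + 1)) * exp (- I s)"])
    fix s assume "s \<ge> T"
    then show "(H has_real_derivative (E' s - k s * (E s + 1)) * exp (- I s)) (at s)"
      unfolding H_def by (auto intro!: derivative_eq_intros E I' simp: algebra_simps)
    show "(E' s - k s * (E s + 1)) * exp (- I s) \<le> 0"
      using le[OF \<open>s \<ge> T\<close>] by (simp add: mult_nonpos_nonneg)
  qed (use that in auto)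
  moreover have "E t + 1 = H t * exp (I t)" for t
    by (simp add: H_def flip: exp_add)
  moreover have "I t \<le> S" for t
    unfolding I_def S_def by (rule integral_le_set_lebesgue_integral[OF k])
  moreover have "H T \<ge> 0" using nn[of T] by (simp add: H_def)
  ultimately have "E t + 1 \<le> H T * exp S" if "t \<ge> T" for t
    using that mult_mono[of "H t" "H T" "exp (I t)" "exp S"] by simp
  then have "E t \<le> H T * exp S - 1" if "t \<ge> T" for t using that by (simp add: le_diff_eq)
  then show ?thesis by blast
qed

text \<open>\<open>E\<close> plus \<open>c\<close> times the integral of \<open>F\<close> minus the
  integral of \<open>k\<close> is non-increasing. Since \<open>E\<close> is nonnegative and
  \<open>k\<close> has finite integral, the integral of \<open>F\<close> stays bounded.\<close>

lemma set_integrable_dissipation: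
  fixes E k F :: "real \<Rightarrow> real"
  assumes k: "continuous_on {a..} k" "\<And>t. t \<ge> a \<Longrightarrow> 0 \<le> k t" "set_integrable lborel {a..} k"
    and T: "a < T"
    and E: "\<And>t. t \<ge> T \<Longrightarrow> (E has_real_derivative E' t) (at t)"
    and le: "\<And>t. t \<ge> T \<Longrightarrow> E' t + c * F t \<le> k t" and c: "0 < c"
    and nn: "\<And>t. t \<ge> T \<Longrightarrow> 0 \<le> E t"
    and F: "continuous_on {a..} F" "\<And>t. t \<ge> a \<Longrightarrow> 0 \<le> F t"
  shows "set_integrable lborel {a..} F"
proof -
  define H where "H t = E t + c * integral {a..t} F - integral {a..t} k" for t
  define S where "S = (LINT s:{a..}|lborel. k s)"
  have H: "H t \<le> H T" if "t \<ge> T" for t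
  proof (rule DERIV_nonpos_imp_antimono_halfline[of T H "\<lambda>s. E' s + c * F s - k s"])
    fix s assume "s \<ge> T"
    then show "(H has_real_derivative E' s + c * F s - k s) (at s)"
      unfolding H_def using T
      by (auto intro!: derivative_eq_intros E has_real_derivative_integral[OF k(1)]
          has_real_derivative_integral[OF F(1)])
    show "E' s + c * F s - k s \<le> 0" using le[OF \<open>s \<ge> T\<close>] by simp
  qed (use that in auto)
  have "integral {a..t} F \<le> (H T + S) / c" if "t \<ge> T" for t
    using H[OF that] nn[OF that] integral_le_set_lebesgue_integral[OF k, of t] c
    unfolding H_def S_def by (simp add: field_simps)
  then show ?thesis using set_integrable_halfline_bounded[OF F, of T] by blast
qed

text \<open>Subtracting the primitive \<open>I\<close> of \<open>k\<close> makes \<open>E\<close>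
  non-increasing and bounded below. \<open>I\<close> is itself monotone and bounded, so it converges
  and can be added back.\<close>

lemma tendsto_of_derivative_le_integrable:
  fixes E k :: "real \<Rightarrow> real"
  assumes k: "continuous_on {a..} k" "\<And>t. t \<ge> a \<Longrightarrow> 0 \<le> k t" "set_integrable lborel {a..} k"
    and T: "a < T"
    and E: "\<And>t. t \<ge> T \<Longrightarrow> (E has_real_derivative E' t) (at t)"
    and le: "\<And>t. t \<ge> T \<Longrightarrow> E' t \<le> k t"
    and nn: "\<And>t. t \<ge> T \<Longrightarrow> 0 \<le> E t"
  shows "\<exists>l. (E \<longlongrightarrow> l) at_top"
proof -
  define I where "I t = integral {a..t} k" for t
  define S where "S = (LINT s:{a..}|lborel. k s)"
  have I': "(I has_real_derivative k t) (at t)" if "t \<ge> T" for t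
    unfolding I_def using has_real_derivative_integral[OF k(1)] that T by simp
  have IS: "I t \<le> S" for t
    unfolding I_def S_def by (rule integral_le_set_lebesgue_integral[OF k])
  have "\<exists>l. ((\<lambda>t. E t - I t) \<longlongrightarrow> l) at_top"
  proof (rule antimono_bounded_tendsto)
    fix s t assume "T \<le> s" "s \<le> t"
    then show "E t - I t \<le> E s - I s"
      by (rule DERIV_nonpos_imp_antimono_halfline[of T _ "\<lambda>t. E' t - k t", rotated 2])
         (auto intro!: derivative_eq_intros E I' simp: le)
  next
    fix t assume "T \<le> t"
    then show "- S \<le> E t - I t" using nn IS[of t] by force
  qed
  moreover have "\<exists>l. ((\<lambda>t. - I t) \<longlongrightarrow> l) at_top"
  proof (rule antimono_bounded_tendsto)
    fix s t assume "T \<le> s" "s \<le> t"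
    then show "- I t \<le> - I s"
      by (rule DERIV_nonpos_imp_antimono_halfline[of T _ "\<lambda>t. - k t", rotated 2])
         (use T k(2) in \<open>auto intro!: derivative_eq_intros I'\<close>)
  next
    fix t show "- S \<le> - I t" using IS[of t] by simp
  qed
  ultimately obtain l l' where "((\<lambda>t. E t - I t) \<longlongrightarrow> l) at_top" "((\<lambda>t. - I t) \<longlongrightarrow> l') at_top"
    by blast
  then have "((\<lambda>t. (E t - I t) - (- I t)) \<longlongrightarrow> l - l') at_top" by (rule tendsto_diff)
  then show ?thesis by auto
qed

text \<open>A limit \<open>l > 0\<close> would give \<open>f t \<ge> l / (2 * t)\<close> eventually,
  because \<open>t powr q \<le> t\<close> for \<open>t \<ge> 1\<close>. The integral of
  \<open>f\<close> would then grow at least like a logarithm.\<close>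

lemma limit_zero_of_weighted_integrable:
  fixes L :: "real \<Rightarrow> real"
  assumes lim: "(L \<longlongrightarrow> l) at_top" and q: "q \<le> 1"
    and f: "continuous_on {a..} f" "\<And>t. t \<ge> a \<Longrightarrow> 0 \<le> f t" "set_integrable lborel {a..} f"
    and fL: "\<forall>\<^sub>F t in at_top. L t = t powr q * f t"
  shows "l = 0"
proof -
  have "\<forall>\<^sub>F t in at_top. 0 \<le> L t"
    using fL eventually_ge_at_top[of a] by eventually_elim (simp add: f)
  then have "l \<ge> 0" using tendsto_lowerbound[OF lim] by simp
  moreover have False if "l > 0"
  proof -
    define S where "S = (LINT s:{a..}|lborel. f s)"
    have "\<forall>\<^sub>F t in at_top. L t > l / 2" by (rule order_tendstoD(1)[OF lim]) (use that in simp)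
    then have "\<forall>\<^sub>F t in at_top. L t > l / 2 \<and> L t = t powr q * f t \<and> t > a \<and> t \<ge> 1"
      using fL eventually_gt_at_top[of a] eventually_ge_at_top[of 1] by eventually_elim auto
    then obtain T where T: "\<And>t. t \<ge> T \<Longrightarrow> L t > l / 2 \<and> L t = t powr q * f t \<and> t > a \<and> t \<ge> 1"
      unfolding eventually_at_top_linorder by blast
    have lower: "l / 2 / t \<le> f t" if "t \<ge> T" for t
    proof -
      have t: "t \<ge> 1" "l / 2 \<le> t powr q * f t" "t \<ge> a" using T[OF that] by auto
      have "t powr q * f t \<le> t * f t"
        using t(1,3) q f(2)[of t] powr_mono[of q 1 t] by (intro mult_right_mono) auto
      then show ?thesis using t by (simp add: field_simps)
    qed
    define H where "H t = l / 2 * ln t - integral {a..t} f" for t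
    have H: "H t \<le> H T" if "t \<ge> T" for t
    proof (rule DERIV_nonpos_imp_antimono_halfline[of T H "\<lambda>s. l / 2 / s - f s"])
      fix s assume "s \<ge> T"
      then show "(H has_real_derivative l / 2 / s - f s) (at s)"
        unfolding H_def using T[of s]
        by (auto intro!: derivative_eq_intros has_real_derivative_integral[OF f(1)])
      show "l / 2 / s - f s \<le> 0" using lower[OF \<open>s \<ge> T\<close>] by simp
    qed (use that in auto)
    have "ln t \<le> (H T + S) * 2 / l" if "t \<ge> T" for t
      using H[OF that] integral_le_set_lebesgue_integral[OF f, of t] \<open>l > 0\<close>
      unfolding H_def S_def by (simp add: field_simps)
    moreover have "\<forall>\<^sub>F t in at_top. ln t > (H T + S) * 2 / l"
      using ln_at_top filterlim_at_top_dense by blast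
    then have "\<exists>t\<ge>T. ln t > (H T + S) * 2 / l"
      unfolding eventually_at_top_linorder by (metis linorder_linear)
    ultimately show False by force
  qed
  ultimately show ?thesis by force
qed

lemma antimono_on_imp_deriv_nonpos:
  fixes f :: "real \<Rightarrow> real"
  assumes "antimono_on A f" "(f has_real_derivative D) (at t)" "t \<in> interior A"
  shows "D \<le> 0"
proof -
  have "mono_on A (\<lambda>t. - f t)" using assms(1) by (auto simp: monotone_on_def)
  then have "- D \<ge> 0"
    by (rule mono_on_imp_deriv_nonneg) (use assms in \<open>auto intro!: derivative_eq_intros\<close>)
  then show ?thesis by simp
qed

lemma smallo_from_tendsto_zero:
  fixes f h :: "real \<Rightarrow> real"
  assumes "((\<lambda>t. f t * h t) \<longlongrightarrow> 0) at_top" "\<forall>\<^sub>F t in at_top. h t \<noteq> 0"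
  shows "f \<in> o[at_top](\<lambda>t. 1 / h t)"
  by (rule smalloI_tendsto) (use assms in \<open>auto elim!: eventually_mono\<close>)

section \<open>Energy estimates\<close>

text \<open>The left side is the derivative of \<open>W\<close> along the trajectory, with
  \<open>d\<close> the gradient at \<open>x + b v\<close>. Inserting the equation for
  \<open>w\<close> cancels \<open>d \<bullet> v\<close> and \<open>e * (x \<bullet> v)\<close>. The
  dissipation in \<open>v\<close> and \<open>d\<close> remains, with two cross terms; Young's
  inequality charges an eighth of the first and a half of the second to them.\<close>

lemma mechanical_energy_derivative_le:
  fixes x v w d :: "'a::real_inner"
  assumes p: "0 < p" and b: "0 \<le> b" and e': "e' \<le> 0" and \<alpha>: "0 < \<alpha>"
    and w: "w + (\<alpha> / p) *\<^sub>R v + d + e *\<^sub>R x = 0"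
    and b': "\<bar>b'\<bar> \<le> b / p" and bp: "(1 + \<alpha>)\<^sup>2 * b \<le> \<alpha> / 8 * p"
    and e: "0 \<le> e"
  shows "v \<bullet> w + d \<bullet> (v + b' *\<^sub>R v + b *\<^sub>R w) + e' / 2 * (norm x)\<^sup>2 + e * (x \<bullet> v)
    \<le> - (7 / 8 * \<alpha> / p * (norm v)\<^sup>2) - b / 2 * (norm d)\<^sup>2 + b * e\<^sup>2 * (norm x)\<^sup>2"
proof -
  have w': "w = - ((\<alpha> / p) *\<^sub>R v) - d - e *\<^sub>R x"
    using w by (simp add: eq_neg_iff_add_eq_0 algebra_simps)
  have "v \<bullet> w + d \<bullet> (v + b' *\<^sub>R v + b *\<^sub>R w) + e' / 2 * (norm x)\<^sup>2 + e * (x \<bullet> v)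
      = - (\<alpha> / p * (norm v)\<^sup>2) + (b' - b * \<alpha> / p) * (d \<bullet> v) - b * (norm d)\<^sup>2
        - b * e * (d \<bullet> x) + e' / 2 * (norm x)\<^sup>2"
    unfolding w' power2_norm_eq_inner by (simp add: inner_simps inner_commute algebra_simps)
  moreover have "e' / 2 * (norm x)\<^sup>2 \<le> 0" using e' by (simp add: mult_nonpos_nonneg)
  moreover have "(b' - b * \<alpha> / p) * (d \<bullet> v) \<le> b / 4 * (norm d)\<^sup>2 + \<alpha> / 8 / p * (norm v)\<^sup>2"
  proof -
    have "\<bar>b' - b * \<alpha> / p\<bar> \<le> b / p + b * \<alpha> / p"
      using b' b \<alpha> p by (intro order_trans[OF abs_triangle_ineq4]) (simp add: abs_mult)
    also have "\<dots> = (1 + \<alpha>) * b / p" by (simp add: add_divide_distrib algebra_simps)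
    finally have "\<bar>b' - b * \<alpha> / p\<bar> * \<bar>d \<bullet> v\<bar> \<le> ((1 + \<alpha>) * b / p) * (norm d * norm v)"
      using Cauchy_Schwarz_ineq2[of d v] b \<alpha> p by (intro mult_mono) auto
    then have "(b' - b * \<alpha> / p) * (d \<bullet> v) \<le> ((1 + \<alpha>) * b / p) * (norm d * norm v)"
      by (metis abs_ge_self abs_mult order_trans)
    \<comment> \<open>Young's inequality as a square, weighted so that \<open>d\<close> costs
      \<open>b / 4\<close>. The hypothesis \<open>bp\<close> is exactly what bounds the resulting
      cost in \<open>v\<close> by \<alpha> / (8 p).\<close>
    moreover have "0 \<le> b * (norm d / 2 - (1 + \<alpha>) / p * norm v)\<^sup>2" using b by simp
    moreover have "b * (norm d / 2 - (1 + \<alpha>) / p * norm v)\<^sup>2 = b / 4 * (norm d)\<^sup>2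
        - ((1 + \<alpha>) * b / p) * (norm d * norm v) + (1 + \<alpha>)\<^sup>2 * b / p\<^sup>2 * (norm v)\<^sup>2"
      using p by (simp add: power2_eq_square field_simps)
    moreover have "(1 + \<alpha>)\<^sup>2 * b / p\<^sup>2 \<le> \<alpha> / 8 / p"
      using divide_right_mono[OF bp, of "p\<^sup>2"] p by (simp add: power2_eq_square)
    then have "(1 + \<alpha>)\<^sup>2 * b / p\<^sup>2 * (norm v)\<^sup>2 \<le> \<alpha> / 8 / p * (norm v)\<^sup>2"
      by (rule mult_right_mono) simp
    ultimately show ?thesis by linarith
  qed
  moreover have "- (b * e * (d \<bullet> x)) \<le> b / 4 * (norm d)\<^sup>2 + b * e\<^sup>2 * (norm x)\<^sup>2"
  proof -
    have "- (d \<bullet> x) \<le> norm d * norm x"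
      using Cauchy_Schwarz_ineq2[of d x] by linarith
    then have "(b * e) * - (d \<bullet> x) \<le> (b * e) * (norm d * norm x)"
      using b e by (intro mult_left_mono) auto
    moreover have "0 \<le> b * (norm d / 2 - e * norm x)\<^sup>2" using b by simp
    ultimately show ?thesis
      by (simp add: power2_diff power_divide power_mult_distrib algebra_simps power2_eq_square)
  qed
  moreover have "\<alpha> / p * (norm v)\<^sup>2 = 7 / 8 * \<alpha> / p * (norm v)\<^sup>2 + \<alpha> / 8 / p * (norm v)\<^sup>2"
    by (simp add: field_simps)
  ultimately show ?thesis by linarith
qed

text \<open>
  The coefficient \<open>\<alpha> - q * (p / t)\<close> of the anchor term is the one that cancels the cross terms
  \<open>(x - z) \<bullet> v\<close>. Its derivative \<open>q * (1 - q) * (p / t\<^sup>2)\<close> is absorbed by the Tikhonov term, which is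
  where the lower bound on \<open>e\<close> enters; the upper bound controls \<open>p\<^sup>2 * b * e\<^sup>2\<close> by a multiple of \<open>p * e\<close>.
\<close>

lemma anchored_energy_derivative_le:
  fixes x v w d z :: "'a::real_inner"
  assumes p: "0 < p" and t: "0 < t" and b: "0 \<le> b" "b \<le> B" and \<alpha>: "0 < \<alpha>"
    and w: "w + (\<alpha> / p) *\<^sub>R v + d + e *\<^sub>R x = 0"
    and bp: "(1 + \<alpha>)\<^sup>2 * b \<le> \<alpha> / 8 * p"
    and q: "q * (p / t) \<le> \<alpha> / 16"
    and e: "0 \<le> e" "q * (1 - q) / t\<^sup>2 \<le> e" "p * e \<le> K"
    and G: "0 \<le> G" "G \<le> d \<bullet> (x + b *\<^sub>R v - z)"
    and dW: "dW \<le> - (7 / 8 * \<alpha> / p * (norm v)\<^sup>2) - b / 2 * (norm d)\<^sup>2 + b * e\<^sup>2 * (norm x)\<^sup>2"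
    and W: "W = (norm v)\<^sup>2 / 2 + G + e / 2 * (norm x)\<^sup>2"
  shows "2 * p * (q * (p / t)) * W + p\<^sup>2 * dW
      + \<alpha> / 4 * (q * (p / t) * ((x - z) \<bullet> v) + p * ((norm v)\<^sup>2 + (x - z) \<bullet> w))
      + \<alpha> / 4 * (q * (1 - q) * (p / t\<^sup>2) * (norm (x - z))\<^sup>2 / 2 + (\<alpha> - q * (p / t)) * ((x - z) \<bullet> v))
      + \<alpha> / 8 * (p * W) + b / 4 * (p\<^sup>2 * (norm d)\<^sup>2)
    \<le> p * e * (B * K * (norm x)\<^sup>2 + \<alpha> / 8 * (norm z)\<^sup>2)"
proof -
  have w': "w = - ((\<alpha> / p) *\<^sub>R v) - d - e *\<^sub>R x"
    using w by (simp add: eq_neg_iff_add_eq_0 algebra_simps)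
  \<comment> \<open>Differentiating the weight \<open>p\<^sup>2\<close> costs only \<alpha> / 8 of
    \<open>p * W\<close>, since \<open>p / t\<close> is small. Together with the \<alpha> / 8 to be
    gained as dissipation this makes the \<alpha> / 4 split up in \<open>A7\<close>.\<close>
  have "2 * p * (q * (p / t)) * W \<le> 2 * p * (\<alpha> / 16) * W"
    using q p G(1) e(1) by (intro mult_right_mono mult_left_mono) (auto simp: W)
  then have A1: "2 * p * (q * (p / t)) * W \<le> \<alpha> / 8 * (p * W)" by simp
  have "p\<^sup>2 * dW \<le> p\<^sup>2 * (- (7 / 8 * \<alpha> / p * (norm v)\<^sup>2) - b / 2 * (norm d)\<^sup>2 + b * e\<^sup>2 * (norm x)\<^sup>2)"
    using dW by (intro mult_left_mono) auto
  also have "\<dots> = - (7 / 8 * \<alpha> * (p * (norm v)\<^sup>2)) - b / 2 * (p\<^sup>2 * (norm d)\<^sup>2)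
      + b * (p * e) * (p * e * (norm x)\<^sup>2)"
    using p by (simp add: field_simps power2_eq_square)
  also have "b * (p * e) * (p * e * (norm x)\<^sup>2) \<le> B * K * (p * e * (norm x)\<^sup>2)"
    using p b e by (intro mult_right_mono mult_mono) auto
  finally have A2: "p\<^sup>2 * dW \<le> - (7 / 8 * \<alpha> * (p * (norm v)\<^sup>2)) - b / 2 * (p\<^sup>2 * (norm d)\<^sup>2)
      + B * K * (p * e * (norm x)\<^sup>2)" by simp
  \<comment> \<open>Polarization of \<open>x \<bullet> (x - z)\<close>. Of the three squares, that
    of \<open>x\<close> pays for the Tikhonov part of \<open>W\<close>, that of \<open>x - z\<close>
    pays for \<open>A6\<close>, and that of \<open>z\<close> stays on the right as a source.\<close>
  have A3: "p * ((x - z) \<bullet> w) = - (\<alpha> * ((x - z) \<bullet> v)) - p * (d \<bullet> (x + b *\<^sub>R v - z))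
      + p * b * (d \<bullet> v) - p * e * ((norm x)\<^sup>2 + (norm (x - z))\<^sup>2 - (norm z)\<^sup>2) / 2"
    unfolding w' power2_norm_eq_inner using p
    by (simp add: inner_simps inner_commute field_simps)
  have A4: "p * G \<le> p * (d \<bullet> (x + b *\<^sub>R v - z))" using G(2) p by simp
  \<comment> \<open>The last cross term. It uses the \<open>b / 4\<close> of the gradient
    dissipation that is left besides the \<open>b / 4\<close> kept in the conclusion.\<close>
  have A5: "\<alpha> / 4 * (p * b * (d \<bullet> v)) \<le> b / 4 * (p\<^sup>2 * (norm d)\<^sup>2) + \<alpha> / 8 * (p * (norm v)\<^sup>2)"
  proof -
    have "(\<alpha> / 4 * (p * b)) * (d \<bullet> v) \<le> (\<alpha> / 4 * (p * b)) * (norm d * norm v)"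
      using \<alpha> p b norm_cauchy_schwarz by (intro mult_left_mono) auto
    moreover have "0 \<le> b * (p * norm d / 2 - \<alpha> / 4 * norm v)\<^sup>2" using b by simp
    moreover have "b * (p * norm d / 2 - \<alpha> / 4 * norm v)\<^sup>2
        = b / 4 * (p\<^sup>2 * (norm d)\<^sup>2) - (\<alpha> / 4 * (p * b)) * (norm d * norm v) + (\<alpha> / 4)\<^sup>2 * b * (norm v)\<^sup>2"
      by (simp add: power2_eq_square field_simps)
    moreover have "(\<alpha> / 4)\<^sup>2 * b \<le> \<alpha> / 8 * p"
      using \<alpha> b by (intro order_trans[OF mult_right_mono bp] power_mono) auto
    then have "(\<alpha> / 4)\<^sup>2 * b * (norm v)\<^sup>2 \<le> \<alpha> / 8 * p * (norm v)\<^sup>2"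
      by (rule mult_right_mono) simp
    ultimately show ?thesis by (simp add: algebra_simps)
  qed
  have "q * (1 - q) * (p / t\<^sup>2) \<le> p * e"
    using mult_left_mono[OF e(2), of p] p by (simp add: field_simps)
  then have "q * (1 - q) * (p / t\<^sup>2) * (norm (x - z))\<^sup>2 \<le> p * e * (norm (x - z))\<^sup>2"
    by (rule mult_right_mono) simp
  then have A6: "\<alpha> / 8 * (q * (1 - q) * (p / t\<^sup>2) * (norm (x - z))\<^sup>2) \<le> \<alpha> / 8 * (p * e * (norm (x - z))\<^sup>2)"
    using \<alpha> by (intro mult_left_mono) auto
  have A7: "\<alpha> / 4 * (p * W) = \<alpha> / 8 * (p * (norm v)\<^sup>2) + \<alpha> / 4 * (p * G) + \<alpha> / 8 * (p * e * (norm x)\<^sup>2)"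
    unfolding W by (simp add: algebra_simps)
  have A8: "0 \<le> \<alpha> * (p * (norm v)\<^sup>2)" using \<alpha> p by simp
  have A9: "\<alpha> / 4 * (p * G) \<le> \<alpha> / 4 * (p * (d \<bullet> (x + b *\<^sub>R v - z)))"
    using mult_left_mono[OF A4, of "\<alpha> / 4"] \<alpha> by simp
  have "\<alpha> / 4 * (q * (p / t) * ((x - z) \<bullet> v) + p * ((norm v)\<^sup>2 + (x - z) \<bullet> w))
      + \<alpha> / 4 * (q * (1 - q) * (p / t\<^sup>2) * (norm (x - z))\<^sup>2 / 2 + (\<alpha> - q * (p / t)) * ((x - z) \<bullet> v))
      = \<alpha> / 4 * (p * (norm v)\<^sup>2) + \<alpha> / 8 * (q * (1 - q) * (p / t\<^sup>2) * (norm (x - z))\<^sup>2)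
        - \<alpha> / 4 * (p * (d \<bullet> (x + b *\<^sub>R v - z))) + \<alpha> / 4 * (p * b * (d \<bullet> v))
        - \<alpha> / 8 * (p * e * (norm x)\<^sup>2) - \<alpha> / 8 * (p * e * (norm (x - z))\<^sup>2)
        + \<alpha> / 8 * (p * e * (norm z)\<^sup>2)"
    using A3 by (simp only: distrib_left distrib_right left_diff_distrib right_diff_distrib) (simp add: field_simps)
  moreover have "p * e * (B * K * (norm x)\<^sup>2 + \<alpha> / 8 * (norm z)\<^sup>2)
      = B * K * (p * e * (norm x)\<^sup>2) + \<alpha> / 8 * (p * e * (norm z)\<^sup>2)"
    by (simp add: algebra_simps)
  ultimately show ?thesis
    \<comment> \<open>The balance of \<open>p * (norm v)\<^sup>2\<close> is -7/8 + 1/4 + 1/8 + 1/8 =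
      -3/8 times \<alpha>, dropped by \<open>A8\<close>. The gradient squares cancel
      exactly.\<close>
    using A1 A2 A5 A6 A7 A8 A9 by linarith
qed

text \<open>Here \<open>s\<close> stands for \<open>q * (p / t)\<close>. Completing the square in
  \<open>p v / 2\<close> and \<alpha> (x - z) / 4 uses 2/32 of \<alpha> squared, and the anchor term
  supplies at least 3/32.\<close>

lemma anchored_energy_ge:
  fixes x v z :: "'a::real_inner"
  assumes "0 < \<alpha>" "s \<le> \<alpha> / 16" "0 \<le> W" "(norm v)\<^sup>2 / 2 \<le> W"
  shows "\<alpha>\<^sup>2 / 32 * (norm (x - z))\<^sup>2
    \<le> p\<^sup>2 * W + \<alpha> / 4 * (p * ((x - z) \<bullet> v)) + \<alpha> / 4 * ((\<alpha> - s) * (norm (x - z))\<^sup>2 / 2)"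
proof -
  have "0 \<le> (norm ((p / 2) *\<^sub>R v + (\<alpha> / 4) *\<^sub>R (x - z)))\<^sup>2" by simp
  also have "\<dots> = p\<^sup>2 / 4 * (norm v)\<^sup>2 + \<alpha> / 4 * (p * ((x - z) \<bullet> v)) + \<alpha>\<^sup>2 / 16 * (norm (x - z))\<^sup>2"
    unfolding power2_norm_eq_inner inner_add_left inner_add_right inner_scaleR_left inner_scaleR_right
    by (simp add: inner_commute power2_eq_square algebra_simps)
  finally have 1: "0 \<le> \<dots>" .
  have "p\<^sup>2 / 4 * (norm v)\<^sup>2 \<le> p\<^sup>2 / 2 * (norm v)\<^sup>2" by (intro mult_right_mono) auto
  also have "\<dots> \<le> p\<^sup>2 * W" using mult_left_mono[OF assms(4), of "p\<^sup>2"] by simp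
  finally have 2: "p\<^sup>2 / 4 * (norm v)\<^sup>2 \<le> p\<^sup>2 * W" .
  have "\<alpha> / 4 * (3 / 4 * \<alpha> * (norm (x - z))\<^sup>2 / 2) \<le> \<alpha> / 4 * ((\<alpha> - s) * (norm (x - z))\<^sup>2 / 2)"
    using assms(1,2) by (intro mult_left_mono divide_right_mono mult_right_mono) auto
  then have 3: "3 / 32 * \<alpha>\<^sup>2 * (norm (x - z))\<^sup>2 \<le> \<alpha> / 4 * ((\<alpha> - s) * (norm (x - z))\<^sup>2 / 2)"
    by (simp add: power2_eq_square algebra_simps)
  show ?thesis using 1 2 3 by linarith
qed

text \<open>The conditions on \<beta>(t) and \<open>p\<close> under which the pointwise energy
  estimates apply. The first compares the derivative of \<beta>(t) with \<beta>(t) / p; the bound by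
  \<gamma> / 2 serves (b).\<close>

lemma eventually_parameters:
  fixes \<alpha> \<beta> \<gamma> q :: real
  assumes \<alpha>: "0 < \<alpha>" and q: "0 < q" "q < 1" and params: "\<gamma> > 0 \<or> (\<gamma> = 0 \<and> \<beta> > 0)"
  shows "\<forall>\<^sub>F t in at_top. \<bar>- (q * \<beta> / t / t powr q)\<bar> \<le> beta_fun \<gamma> \<beta> q t / t powr q \<and>
    beta_fun \<gamma> \<beta> q t \<le> \<gamma> + 1 \<and> \<gamma> / 2 \<le> beta_fun \<gamma> \<beta> q t \<and>
    (1 + \<alpha>)\<^sup>2 * beta_fun \<gamma> \<beta> q t \<le> \<alpha> / 8 * t powr q \<and> q * (t powr q / t) \<le> \<alpha> / 16"
proof -
  define b where "b = beta_fun \<gamma> \<beta> q"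
  have pm: "((\<lambda>t::real. t powr - q) \<longlongrightarrow> 0) at_top"
    using q by (intro tendsto_neg_powr filterlim_ident) auto
  have pt: "((\<lambda>t::real. t powr (q - 1)) \<longlongrightarrow> 0) at_top"
    using q by (intro tendsto_neg_powr filterlim_ident) auto
  have pt': "t powr (q - 1) = t powr q / t" if "t > 0" for t :: real
    using that by (simp add: powr_diff)
  have b: "b t = \<gamma> + \<beta> * t powr - q" for t
    by (simp add: b_def beta_fun_def powr_minus field_simps)
  have blim: "(b \<longlongrightarrow> \<gamma> + \<beta> * 0) at_top"
    unfolding b by (intro tendsto_intros pm)
  have "\<forall>\<^sub>F t in at_top. b t < \<gamma> + 1"
    using order_tendstoD(2)[OF blim] by simp
  moreover have "\<forall>\<^sub>F t in at_top. \<gamma> / 2 \<le> b t"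
  proof (cases "\<gamma> > 0")
    case True
    then have "\<forall>\<^sub>F t in at_top. \<gamma> / 2 < b t" by (intro order_tendstoD(1)[OF blim]) simp
    then show ?thesis by eventually_elim simp
  qed (use params in \<open>auto simp: b\<close>)
  moreover have "\<forall>\<^sub>F t in at_top. (1 + \<alpha>)\<^sup>2 * b t * t powr - q < \<alpha> / 8"
  proof (rule order_tendstoD(2))
    show "((\<lambda>t. (1 + \<alpha>)\<^sup>2 * b t * t powr - q) \<longlongrightarrow> (1 + \<alpha>)\<^sup>2 * (\<gamma> + \<beta> * 0) * 0) at_top"
      by (intro tendsto_intros blim pm)
  qed (use \<alpha> in simp)
  moreover have "\<forall>\<^sub>F t in at_top. q * t powr (q - 1) < \<alpha> / 16"
  proof (rule order_tendstoD(2))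
    show "((\<lambda>t::real. q * t powr (q - 1)) \<longlongrightarrow> q * 0) at_top"
      by (intro tendsto_intros pt)
  qed (use \<alpha> in simp)
  \<comment> \<open>The first conjunct multiplied by \<open>t powr q\<close>. For \<gamma> > 0 the
    left side vanishes while \<open>b\<close> tends to \<gamma>; for \<gamma> = 0 both sides tend to
    0 and \<open>q < 1\<close> decides.\<close>
  moreover have "\<forall>\<^sub>F t in at_top. q * \<bar>\<beta>\<bar> / t \<le> b t"
  proof (cases "\<gamma> > 0")
    case True
    have inv: "((\<lambda>t. q * \<bar>\<beta>\<bar> / t) \<longlongrightarrow> 0) at_top"
      by (intro tendsto_divide_0[OF tendsto_const] filterlim_at_top_imp_at_infinity filterlim_ident)
    have "\<forall>\<^sub>F t in at_top. 0 < b t - q * \<bar>\<beta>\<bar> / t"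
    proof (rule order_tendstoD(1))
      show "((\<lambda>t. b t - q * \<bar>\<beta>\<bar> / t) \<longlongrightarrow> (\<gamma> + \<beta> * 0) - 0) at_top"
        by (intro tendsto_diff blim inv)
    qed (use True in simp)
    then show ?thesis by eventually_elim simp
  next
    case False
    then have \<beta>: "\<gamma> = 0" "\<beta> > 0" using params by auto
    have "\<forall>\<^sub>F t in at_top. t powr (q - 1) < (1::real)"
      by (rule order_tendstoD(2)[OF pt]) simp
    then show ?thesis
      using eventually_gt_at_top[of 0]
    proof eventually_elim
      fix t :: real assume t: "t powr (q - 1) < 1" "0 < t"
      have "q / t \<le> 1 / t" using t q by (simp add: divide_right_mono)
      also have "\<dots> \<le> t powr - q"
        using t pt'[of t] by (simp add: powr_minus field_simps)
      finally have "q / t * \<beta> \<le> t powr - q * \<beta>" using \<beta> by (intro mult_right_mono) auto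
      then show "q * \<bar>\<beta>\<bar> / t \<le> b t" using \<beta> by (simp add: b mult.commute)
    qed
  qed
  ultimately have "\<forall>\<^sub>F t in at_top. \<bar>- (q * \<beta> / t / t powr q)\<bar> \<le> b t / t powr q \<and>
    b t \<le> \<gamma> + 1 \<and> \<gamma> / 2 \<le> b t \<and>
    (1 + \<alpha>)\<^sup>2 * b t \<le> \<alpha> / 8 * t powr q \<and> q * (t powr q / t) \<le> \<alpha> / 16"
    using eventually_gt_at_top[of 0]
  proof eventually_elim
    case (elim t)
    then show ?case
      using q by (auto simp: abs_mult abs_divide divide_right_mono pt' powr_minus field_simps)
  qed
  then show ?thesis by (simp add: b_def)
qed

theorem theorem5:
  fixes g :: "'a::{real_inner, complete_space} \<Rightarrow> real"
    and t0 \<alpha> q \<gamma> \<beta> :: real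
    and \<epsilon> :: "real \<Rightarrow> real"
    and u0 v0 :: 'a
    and x x' x'' :: "real \<Rightarrow> 'a"
  assumes g_convex: "convex_on UNIV g"
    and g_diff: "\<forall>y. g differentiable (at y)"
    and g_lip: "\<forall>B. bounded B \<longrightarrow> (\<exists>L. L-lipschitz_on B (gradient g))"
    and g_argmin: "\<exists>z. is_arg_min g (\<lambda>_. True) z"
    and t0_pos: "t0 > 0"
    and alpha_pos: "\<alpha> > 0"
    and q_range: "0 < q" "q < 1"
    and params: "\<gamma> > 0 \<or> (\<gamma> = 0 \<and> \<beta> > 0)"
    and t0_large: "\<beta> < 0 \<longrightarrow> t0 > \<bar>\<beta> / \<gamma>\<bar> powr (1 / q)"
    and eps_nonneg: "\<forall>t\<ge>t0. \<epsilon> t \<ge> 0"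
    and eps_antimono: "antimono_on {t0..} \<epsilon>"
    and eps_C1: "C1_on_halfline t0 \<epsilon>"
    and eps_lim: "(\<epsilon> \<longlongrightarrow> 0) at_top"
    and sol: "DS_solution g t0 \<alpha> q \<gamma> \<beta> \<epsilon> u0 v0 x x' x''"
    and eps_bounds: "\<exists>K>0. \<forall>\<^sub>F t in at_top. q * (1 - q) / t\<^sup>2 \<le> \<epsilon> t \<and> \<epsilon> t \<le> K / t powr q"
    and eps_int: "set_integrable lborel {t0..} (\<lambda>t. t powr q * \<epsilon> t)"
  shows
    "(set_integrable lborel {t0..} (\<lambda>t. t powr q * (norm (x' t))\<^sup>2) \<and>
      set_integrable lborel {t0..}
        (\<lambda>t. t powr q * (g (x t + beta_fun \<gamma> \<beta> q t *\<^sub>R x' t) - (INF y. g y)))) \<and>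
     ((\<gamma> > 0 \<longrightarrow> set_integrable lborel {t0..}
        (\<lambda>t. t powr (2 * q) * (norm (gradient g (x t + beta_fun \<gamma> \<beta> q t *\<^sub>R x' t)))\<^sup>2)) \<and>
      (\<gamma> = 0 \<and> \<beta> > 0 \<longrightarrow> set_integrable lborel {t0..}
        (\<lambda>t. t powr q * (norm (gradient g (x t + beta_fun \<gamma> \<beta> q t *\<^sub>R x' t)))\<^sup>2))) \<and>
     ((\<lambda>t. norm (x' t)) \<in> o[at_top](\<lambda>t. 1 / t powr q) \<and>
      (\<lambda>t. g (x t + beta_fun \<gamma> \<beta> q t *\<^sub>R x' t) - (INF y. g y)) \<in> o[at_top](\<lambda>t. 1 / t powr (2 * q)) \<and>
      (\<lambda>t. norm (x t)) \<in> o[at_top](\<lambda>t. 1 / (t powr q * sqrt (\<epsilon> t))))"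
proof -

  \<comment> \<open>Notation along the trajectory, minimizer and gradient\<close>
  define p where "p t = t powr q" for t
  define b where "b = beta_fun \<gamma> \<beta> q"
  define b' where "b' t = - (q * \<beta> / t / p t)" for t
  define y where "y t = x t + b t *\<^sub>R x' t" for t
  define d where "d t = gradient g (y t)" for t
  have x: "(x has_vector_derivative x' t) (at t within {t0..})"
    and x': "(x' has_vector_derivative x'' t) (at t within {t0..})"
    and ode: "x'' t + (\<alpha> / p t) *\<^sub>R x' t + d t + \<epsilon> t *\<^sub>R x t = 0" if "t \<ge> t0" for t
    using sol that unfolding DS_solution_def p_def d_def y_def b_def by auto
  obtain z where z: "\<And>u. g z \<le> g u"
    using g_argmin unfolding is_arg_min_def by (auto simp: not_less)
  have inf: "(INF u. g u) = g z"
    using z by (intro cInf_eq_minimum) auto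
  define G where "G t = g (y t) - g z" for t
  have G_nonneg: "0 \<le> G t" for t using z by (simp add: G_def)
  obtain \<epsilon>' where \<epsilon>': "\<And>t. t \<ge> t0 \<Longrightarrow> (\<epsilon> has_real_derivative \<epsilon>' t) (at t within {t0..})"
    using eps_C1 unfolding C1_on_halfline_def by blast
  have at: "at t within {t0..} = at t" if "t > t0" for t
    using that by (intro at_within_interior) (simp add: interior_real_atLeast)
  have grad: "GDERIV g u :> gradient g u" for u
    using g_diff by (intro GDERIV_gradient) auto

  \<comment> \<open>Continuity on the half-line\<close>
  have cont_x: "continuous_on {t0..} x" "continuous_on {t0..} x'"
    using x x' by (auto simp: continuous_on_eq_continuous_within intro: has_vector_derivative_continuous)
  have cont_\<epsilon>: "continuous_on {t0..} \<epsilon>"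
    using \<epsilon>' by (auto simp: continuous_on_eq_continuous_within intro: DERIV_continuous)
  have cont_p: "continuous_on {t0..} p"
    unfolding p_def using t0_pos by (intro continuous_intros) auto
  have p_nonneg: "0 \<le> p t" for t by (simp add: p_def)
  have p_pos: "0 < p t" if "t \<ge> t0" for t using that t0_pos by (simp add: p_def)
  have cont_y: "continuous_on {t0..} y"
    unfolding y_def b_def beta_fun_def using t0_pos
    by (intro continuous_intros cont_x) auto
  have cont_d: "continuous_on {t0..} d"
    unfolding d_def using continuous_on_compose2[OF continuous_gradient[OF g_lip] cont_y] by auto
  have "continuous_on UNIV g"
    using g_diff by (simp add: continuous_at_imp_continuous_on differentiable_imp_continuous_within)
  then have cont_G: "continuous_on {t0..} G"
    unfolding G_def using continuous_on_compose2[OF _ cont_y, of UNIV g] by (intro continuous_intros) auto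

  \<comment> \<open>A time after which all parameter estimates hold\<close>
  obtain K where K: "K > 0" and epsK:
    "\<forall>\<^sub>F t in at_top. q * (1 - q) / t\<^sup>2 \<le> \<epsilon> t \<and> \<epsilon> t \<le> K / t powr q"
    using eps_bounds by blast
  define B where "B = \<gamma> + 1"
  have B: "B > 0" using params by (auto simp: B_def)
  have "\<forall>\<^sub>F t in at_top. t0 < t \<and> \<bar>b' t\<bar> \<le> b t / p t \<and> b t \<le> B \<and> \<gamma> / 2 \<le> b t \<and>
      (1 + \<alpha>)\<^sup>2 * b t \<le> \<alpha> / 8 * p t \<and> q * (p t / t) \<le> \<alpha> / 16 \<and>
      q * (1 - q) / t\<^sup>2 \<le> \<epsilon> t \<and> p t * \<epsilon> t \<le> K"
    using eventually_parameters[OF alpha_pos q_range params] epsK eventually_gt_at_top[of t0]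
    unfolding b'_def b_def p_def B_def
  proof eventually_elim
    case (elim t)
    then show ?case using p_pos[of t] by (auto simp: p_def field_simps)
  qed
  then obtain T where T: "\<And>t. t \<ge> T \<Longrightarrow> t0 < t \<and> \<bar>b' t\<bar> \<le> b t / p t \<and> b t \<le> B \<and> \<gamma> / 2 \<le> b t \<and>
      (1 + \<alpha>)\<^sup>2 * b t \<le> \<alpha> / 8 * p t \<and> q * (p t / t) \<le> \<alpha> / 16 \<and>
      q * (1 - q) / t\<^sup>2 \<le> \<epsilon> t \<and> p t * \<epsilon> t \<le> K"
    unfolding eventually_at_top_linorder by blast
  have T_gt: "t0 < T" using T[of T] by simp
  have pos: "0 < t" "t0 < t" "0 < p t" "0 \<le> \<epsilon> t" if "t \<ge> T" for t
    using T[OF that] t0_pos eps_nonneg p_pos[of t] by auto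
  have b_nonneg: "0 \<le> b t" if "t \<ge> T" for t
  proof -
    \<comment> \<open>The sign of \<open>b\<close> comes from the bound on its derivative:
      \<open>0 \<le> \<bar>b' t\<bar> \<le> b t / p t\<close>.\<close>
    have "0 \<le> b t / p t" using T[OF that] abs_ge_zero order_trans by blast
    then show ?thesis using pos[OF that] by (simp add: zero_le_divide_iff)
  qed

  \<comment> \<open>Mechanical and anchored energies\<close>
  define W where "W t = (norm (x' t))\<^sup>2 / 2 + G t + \<epsilon> t / 2 * (norm (x t))\<^sup>2" for t
  define W' where "W' t = x' t \<bullet> x'' t + d t \<bullet> (x' t + b' t *\<^sub>R x' t + b t *\<^sub>R x'' t)
      + \<epsilon>' t / 2 * (norm (x t))\<^sup>2 + \<epsilon> t * (x t \<bullet> x' t)" for t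
  define E where "E t = (p t)\<^sup>2 * W t + \<alpha> / 4 * (p t * ((x t - z) \<bullet> x' t))
      + \<alpha> / 4 * ((\<alpha> - q * (p t / t)) * (norm (x t - z))\<^sup>2 / 2)" for t
  define E' where "E' t = 2 * p t * (q * (p t / t)) * W t + (p t)\<^sup>2 * W' t
      + \<alpha> / 4 * (q * (p t / t) * ((x t - z) \<bullet> x' t) + p t * ((norm (x' t))\<^sup>2 + (x t - z) \<bullet> x'' t))
      + \<alpha> / 4 * (q * (1 - q) * (p t / t\<^sup>2) * (norm (x t - z))\<^sup>2 / 2
        + (\<alpha> - q * (p t / t)) * ((x t - z) \<bullet> x' t))" for t
  have W_ge: "(norm (x' t))\<^sup>2 / 2 \<le> W t" "G t \<le> W t" "\<epsilon> t / 2 * (norm (x t))\<^sup>2 \<le> W t" "0 \<le> W t"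
    if "t \<ge> t0" for t
    using G_nonneg[of t] eps_nonneg that unfolding W_def by auto
  have cont_W: "continuous_on {t0..} W"
    unfolding W_def by (intro continuous_intros cont_x cont_G cont_\<epsilon>) auto

  \<comment> \<open>Derivatives of the energies\<close>
  have dp: "(p has_real_derivative q * (p t / t)) (at t)" if "t \<ge> T" for t
    unfolding p_def using pos[OF that]
    by (auto intro!: derivative_eq_intros simp: powr_diff)
  \<comment> \<open>The origin of the term \<open>q * (1 - q) * (p t / t\<^sup>2)\<close> in
    \<open>E'\<close>, and hence of the lower bound demanded of \<epsilon>.\<close>
  have dpt: "((\<lambda>t. p t / t) has_real_derivative - ((1 - q) * (p t / t\<^sup>2))) (at t)" if "t \<ge> T" for t
    using pos[OF that]
    by (auto intro!: derivative_eq_intros dp[OF that] simp: power2_eq_square field_simps)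
  have dx: "(x has_vector_derivative x' t) (at t)" "(x' has_vector_derivative x'' t) (at t)"
    "(\<epsilon> has_real_derivative \<epsilon>' t) (at t)" if "t \<ge> T" for t
    using x[of t] x'[of t] \<epsilon>'[of t] pos(2)[OF that] by (auto simp: at)
  have db: "(b has_real_derivative b' t) (at t)" if "t \<ge> T" for t
  proof -
    have "((\<lambda>t. \<gamma> + \<beta> / p t) has_real_derivative b' t) (at t)"
      using pos[OF that] unfolding b'_def
      by (auto intro!: derivative_eq_intros dp[OF that] simp: field_simps)
    then show ?thesis by (simp add: b_def beta_fun_def[abs_def] p_def)
  qed
  have dy: "(y has_vector_derivative x' t + b' t *\<^sub>R x' t + b t *\<^sub>R x'' t) (at t)" if "t \<ge> T" for t
    unfolding y_def using that
    by (auto intro!: derivative_eq_intros dx db)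
  have dG: "(G has_real_derivative d t \<bullet> (x' t + b' t *\<^sub>R x' t + b t *\<^sub>R x'' t)) (at t)" if "t \<ge> T" for t
    unfolding G_def d_def
    using GDERIV_compose_vector[OF grad dy[OF that]] by (auto intro!: derivative_eq_intros)
  have dW: "(W has_real_derivative W' t) (at t)" if "t \<ge> T" for t
    unfolding W_def W'_def
    by (rule DERIV_cong[OF DERIV_add[OF DERIV_add[OF
              DERIV_cdivide[OF has_real_derivative_norm_square[OF dx(2)[OF that]]] dG[OF that]]
            DERIV_mult[OF DERIV_cdivide[OF dx(3)[OF that]]
              has_real_derivative_norm_square[OF dx(1)[OF that]]]]])
       (simp add: field_simps)
  have dp2W: "((\<lambda>t. (p t)\<^sup>2 * W t) has_real_derivative 2 * p t * (q * (p t / t)) * W t + (p t)\<^sup>2 * W' t) (at t)"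
    if "t \<ge> T" for t
    by (auto intro!: derivative_eq_intros dp dW that)
  have dE: "(E has_real_derivative E' t) (at t)" if "t \<ge> T" for t
  proof -
    have xz: "((\<lambda>t. x t - z) has_vector_derivative x' t) (at t)"
      by (auto intro!: derivative_eq_intros dx that)
    have "((\<lambda>t. p t * ((x t - z) \<bullet> x' t)) has_real_derivative
        q * (p t / t) * ((x t - z) \<bullet> x' t) + p t * ((norm (x' t))\<^sup>2 + (x t - z) \<bullet> x'' t)) (at t)"
      by (auto intro!: derivative_eq_intros has_real_derivative_inner xz dx dp that
          simp: power2_norm_eq_inner)
    moreover have "((\<lambda>t. (\<alpha> - q * (p t / t)) * (norm (x t - z))\<^sup>2 / 2) has_real_derivative
        q * (1 - q) * (p t / t\<^sup>2) * (norm (x t - z))\<^sup>2 / 2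
        + (\<alpha> - q * (p t / t)) * ((x t - z) \<bullet> x' t)) (at t)"
      by (rule DERIV_cong[OF DERIV_cdivide[OF DERIV_mult[OF
                DERIV_diff[OF DERIV_const DERIV_cmult[OF dpt[OF that]]]
                has_real_derivative_norm_square[OF xz]]]])
         (use pos[OF that] in \<open>simp add: field_simps\<close>)
    ultimately show ?thesis
      unfolding E_def E'_def by (intro DERIV_add DERIV_cmult dp2W that)
  qed

  \<comment> \<open>Differential inequality and coercivity of the anchored energy\<close>
  have \<epsilon>'_nonpos: "\<epsilon>' t \<le> 0" if "t \<ge> T" for t
    using antimono_on_imp_deriv_nonpos[OF eps_antimono dx(3)[OF that]] pos(2)[OF that]
    by (simp add: interior_real_atLeast)
  have W'_le: "W' t \<le> - (7 / 8 * \<alpha> / p t * (norm (x' t))\<^sup>2) - b t / 2 * (norm (d t))\<^sup>2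
      + b t * (\<epsilon> t)\<^sup>2 * (norm (x t))\<^sup>2" if "t \<ge> T" for t
    unfolding W'_def
    by (rule mechanical_energy_derivative_le)
       (use T[OF that] pos[OF that] b_nonneg[OF that] \<epsilon>'_nonpos[OF that] ode[of t] alpha_pos in auto)
  have E'_le: "E' t + \<alpha> / 8 * (p t * W t) + b t / 4 * ((p t)\<^sup>2 * (norm (d t))\<^sup>2)
      \<le> p t * \<epsilon> t * (B * K * (norm (x t))\<^sup>2 + \<alpha> / 8 * (norm z)\<^sup>2)" if "t \<ge> T" for t
    unfolding E'_def
  proof (rule anchored_energy_derivative_le[where G = "G t"])
    show "G t \<le> d t \<bullet> (x t + b t *\<^sub>R x' t - z)"
      unfolding G_def d_def y_def by (rule convex_gradient_inequality[OF g_convex grad])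
    show "W t = (norm (x' t))\<^sup>2 / 2 + G t + \<epsilon> t / 2 * (norm (x t))\<^sup>2" by (rule W_def)
  qed (use T[OF that] pos[OF that] b_nonneg[OF that] ode[of t] alpha_pos G_nonneg W'_le[OF that] in auto)
  have E_ge: "\<alpha>\<^sup>2 / 32 * (norm (x t - z))\<^sup>2 \<le> E t" if "t \<ge> T" for t
    unfolding E_def using T[OF that] W_ge[of t] alpha_pos
    by (intro anchored_energy_ge) auto
  have E_nonneg: "0 \<le> E t" if "t \<ge> T" for t
    by (rule order_trans[OF _ E_ge[OF that]]) simp
  have norm_x_le: "(norm (x t))\<^sup>2 \<le> 64 / \<alpha>\<^sup>2 * E t + 2 * (norm z)\<^sup>2" if "t \<ge> T" for t
  proof -
    have "(norm (x t))\<^sup>2 = (norm ((x t - z) + z))\<^sup>2" by simp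
    also have "\<dots> \<le> (norm (x t - z) + norm z)\<^sup>2"
      by (intro power_mono norm_triangle_ineq) simp
    also have "\<dots> \<le> 2 * (norm (x t - z))\<^sup>2 + 2 * (norm z)\<^sup>2"
      using sum_squares_bound[of "norm (x t - z)" "norm z"] by (simp add: power2_sum)
    also have "(norm (x t - z))\<^sup>2 \<le> 32 / \<alpha>\<^sup>2 * E t"
      using E_ge[OF that] alpha_pos by (simp add: field_simps)
    finally show ?thesis by simp
  qed

  \<comment> \<open>Boundedness of the energy and of the trajectory\<close>
  define k where "k t = p t * \<epsilon> t" for t
  have k: "continuous_on {t0..} k" "\<And>t. t \<ge> t0 \<Longrightarrow> 0 \<le> k t" "set_integrable lborel {t0..} k"
    using eps_int eps_nonneg t0_pos
    unfolding k_def by (auto intro!: continuous_intros cont_p cont_\<epsilon> simp: p_def)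
  have k_scale: "continuous_on {t0..} (\<lambda>t. c * k t)" "\<And>t. t \<ge> t0 \<Longrightarrow> 0 \<le> c * k t"
    "set_integrable lborel {t0..} (\<lambda>t. c * k t)" if "c \<ge> 0" for c
    using k that by (auto intro!: continuous_intros set_integrable_mult_right)
  \<comment> \<open>The coefficients that appear when \<open>norm_x_le\<close> is inserted into
    \<open>E'_le\<close>, added up so that \<open>E t + 1\<close> dominates both the part linear in
    \<open>E\<close> and the constant part.\<close>
  define C where "C = B * K * (64 / \<alpha>\<^sup>2) + B * K * (2 * (norm z)\<^sup>2) + \<alpha> / 8 * (norm z)\<^sup>2"
  have C: "0 \<le> C" using B K alpha_pos by (auto simp: C_def)
  have W_diss: "0 \<le> \<alpha> / 8 * (p t * W t)" "0 \<le> b t / 4 * ((p t)\<^sup>2 * (norm (d t))\<^sup>2)" if "t \<ge> T" for t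
    using alpha_pos pos[OF that] W_ge(4)[of t] b_nonneg[OF that] by auto
  have "E' t \<le> C * k t * (E t + 1)" if "t \<ge> T" for t
  proof -
    have "B * K * (norm (x t))\<^sup>2 \<le> B * K * (64 / \<alpha>\<^sup>2 * E t + 2 * (norm z)\<^sup>2)"
      using norm_x_le[OF that] B K by (intro mult_left_mono) auto
    also have "\<dots> + \<alpha> / 8 * (norm z)\<^sup>2 \<le> C * (E t + 1)"
    proof -
      have "0 \<le> (B * K * (2 * (norm z)\<^sup>2) + \<alpha> / 8 * (norm z)\<^sup>2) * E t + B * K * (64 / \<alpha>\<^sup>2)"
        using B K alpha_pos E_nonneg[OF that] by simp
      then show ?thesis unfolding C_def by (simp add: algebra_simps add_divide_distrib)
    qed
    finally have "B * K * (norm (x t))\<^sup>2 + \<alpha> / 8 * (norm z)\<^sup>2 \<le> C * (E t + 1)" by simp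
    then have "k t * (B * K * (norm (x t))\<^sup>2 + \<alpha> / 8 * (norm z)\<^sup>2) \<le> k t * (C * (E t + 1))"
      using k(2)[of t] pos[OF that] by (intro mult_left_mono) auto
    then show ?thesis using E'_le[OF that] W_diss[OF that] unfolding k_def by (simp add: mult_ac)
  qed
  then obtain M where M: "\<And>t. t \<ge> T \<Longrightarrow> E t \<le> M"
    using gronwall_halfline[OF k_scale[OF C] T_gt dE _ E_nonneg] by blast
  define X where "X = 64 / \<alpha>\<^sup>2 * M + 2 * (norm z)\<^sup>2"
  have X: "(norm (x t))\<^sup>2 \<le> X" if "t \<ge> T" for t
    using norm_x_le[OF that] mult_left_mono[OF M[OF that], of "64 / \<alpha>\<^sup>2"] unfolding X_def by simp
  have X_nonneg: "0 \<le> X" by (rule order_trans[OF _ X[of T]]) auto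
  \<comment> \<open>With \<open>x\<close> bounded by \<open>X\<close>, the right side of
    \<open>E'_le\<close> is a constant multiple of the integrable \<open>k\<close> and no longer
    involves \<open>E\<close>.\<close>
  define C1 where "C1 = B * K * X + \<alpha> / 8 * (norm z)\<^sup>2"
  have C1: "0 \<le> C1" using B K X_nonneg alpha_pos by (auto simp: C1_def)
  have E'_le': "E' t + \<alpha> / 8 * (p t * W t) + b t / 4 * ((p t)\<^sup>2 * (norm (d t))\<^sup>2) \<le> C1 * k t"
    if "t \<ge> T" for t
  proof -
    have "k t * (B * K * (norm (x t))\<^sup>2 + \<alpha> / 8 * (norm z)\<^sup>2) \<le> k t * C1"
      unfolding C1_def using X[OF that] B K k(2)[of t] pos[OF that]
      by (intro mult_left_mono add_right_mono) auto
    then show ?thesis using E'_le[OF that] unfolding k_def by (simp add: mult_ac)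
  qed

  \<comment> \<open>Integral estimates\<close>
  have int_F: "set_integrable lborel {t0..} F"
    if "continuous_on {t0..} F" "\<And>t. t \<ge> t0 \<Longrightarrow> 0 \<le> F t" "0 < c"
      "\<And>t. t \<ge> T \<Longrightarrow> c * F t \<le> \<alpha> / 8 * (p t * W t) + b t / 4 * ((p t)\<^sup>2 * (norm (d t))\<^sup>2)" for F c
  proof (rule set_integrable_dissipation[OF k_scale[OF C1] T_gt dE _ that(3) E_nonneg that(1,2)])
    fix t assume t: "t \<ge> T"
    show "E' t + c * F t \<le> C1 * k t" using that(4)[OF t] E'_le'[OF t] by linarith
  qed
  have cont_pW: "continuous_on {t0..} (\<lambda>t. p t * W t)"
    by (intro continuous_intros cont_p cont_W)
  have pW_nonneg: "0 \<le> p t * W t" if "t \<ge> t0" for t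
    using p_pos[OF that] W_ge(4)[OF that] by simp
  have int_pW: "set_integrable lborel {t0..} (\<lambda>t. p t * W t)"
    by (rule int_F[of _ "\<alpha> / 8"]) (use cont_pW pW_nonneg alpha_pos W_diss in auto)
  have int_v: "set_integrable lborel {t0..} (\<lambda>t. p t * (norm (x' t))\<^sup>2)"
  proof (rule int_F[of _ "\<alpha> / 16"])
    show "continuous_on {t0..} (\<lambda>t. p t * (norm (x' t))\<^sup>2)"
      by (intro continuous_intros cont_p cont_x)
    fix t assume t: "t \<ge> T"
    have "\<alpha> / 8 * (p t * ((norm (x' t))\<^sup>2 / 2)) \<le> \<alpha> / 8 * (p t * W t)"
      using alpha_pos W_ge(1)[of t] pos[OF t] by (intro mult_left_mono) auto
    then show "\<alpha> / 16 * (p t * (norm (x' t))\<^sup>2)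
        \<le> \<alpha> / 8 * (p t * W t) + b t / 4 * ((p t)\<^sup>2 * (norm (d t))\<^sup>2)"
      using W_diss(2)[OF t] by linarith
  qed (use alpha_pos p_nonneg in auto)
  have int_G: "set_integrable lborel {t0..} (\<lambda>t. p t * G t)"
  proof (rule int_F[of _ "\<alpha> / 8"])
    show "continuous_on {t0..} (\<lambda>t. p t * G t)"
      by (intro continuous_intros cont_p cont_G)
    fix t assume t: "t \<ge> T"
    have "\<alpha> / 8 * (p t * G t) \<le> \<alpha> / 8 * (p t * W t)"
      using alpha_pos W_ge(2)[of t] pos[OF t] by (intro mult_left_mono) auto
    then show "\<alpha> / 8 * (p t * G t) \<le> \<alpha> / 8 * (p t * W t) + b t / 4 * ((p t)\<^sup>2 * (norm (d t))\<^sup>2)"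
      using W_diss(2)[OF t] by linarith
  qed (use alpha_pos p_nonneg G_nonneg in auto)
  have int_d2: "set_integrable lborel {t0..} (\<lambda>t. (p t)\<^sup>2 * (norm (d t))\<^sup>2)" if "\<gamma> > 0"
  proof (rule int_F[of _ "\<gamma> / 8"])
    show "continuous_on {t0..} (\<lambda>t. (p t)\<^sup>2 * (norm (d t))\<^sup>2)"
      by (intro continuous_intros cont_p cont_d)
    fix t assume t: "t \<ge> T"
    have "\<gamma> / 8 * ((p t)\<^sup>2 * (norm (d t))\<^sup>2) \<le> b t / 4 * ((p t)\<^sup>2 * (norm (d t))\<^sup>2)"
      using T[OF t] by (intro mult_right_mono) auto
    then show "\<gamma> / 8 * ((p t)\<^sup>2 * (norm (d t))\<^sup>2)
        \<le> \<alpha> / 8 * (p t * W t) + b t / 4 * ((p t)\<^sup>2 * (norm (d t))\<^sup>2)"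
      using W_diss(1)[OF t] by linarith
  qed (use that in auto)
  have int_d1: "set_integrable lborel {t0..} (\<lambda>t. p t * (norm (d t))\<^sup>2)" if "\<gamma> = 0" "\<beta> > 0"
  proof (rule int_F[of _ "\<beta> / 4"])
    show "continuous_on {t0..} (\<lambda>t. p t * (norm (d t))\<^sup>2)"
      by (intro continuous_intros cont_p cont_d)
    fix t assume t: "t \<ge> T"
    \<comment> \<open>For \<gamma> = 0 the damping coefficient decays like \<open>1 / p\<close>, so
      one power of \<open>p\<close> is lost in the weight.\<close>
    have "b t = \<beta> / p t" using that by (simp add: b_def beta_fun_def p_def)
    then have "\<beta> / 4 * (p t * (norm (d t))\<^sup>2) = b t / 4 * ((p t)\<^sup>2 * (norm (d t))\<^sup>2)"
      using pos[OF t] by (simp add: power2_eq_square)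
    then show "\<beta> / 4 * (p t * (norm (d t))\<^sup>2)
        \<le> \<alpha> / 8 * (p t * W t) + b t / 4 * ((p t)\<^sup>2 * (norm (d t))\<^sup>2)"
      using W_diss(1)[OF t] by linarith
  qed (use that p_nonneg in auto)

  \<comment> \<open>Convergence of the weighted mechanical energy to zero\<close>
  define k2 where "k2 t = \<alpha> / 8 * (p t * W t) + (B * K * X) * k t" for t
  have BKX: "0 \<le> B * K * X" using B K X_nonneg by simp
  have k2: "continuous_on {t0..} k2" "\<And>t. t \<ge> t0 \<Longrightarrow> 0 \<le> k2 t" "set_integrable lborel {t0..} k2"
    unfolding k2_def using cont_pW k_scale[OF BKX] pW_nonneg alpha_pos int_pW
    by (auto intro!: continuous_intros set_integral_add)
  have p2W'_le: "2 * p t * (q * (p t / t)) * W t + (p t)\<^sup>2 * W' t \<le> k2 t" if "t \<ge> T" for t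
  proof -
    have "2 * p t * (q * (p t / t)) * W t \<le> 2 * p t * (\<alpha> / 16) * W t"
      using T[OF that] pos[OF that] W_ge(4)[of t] by (intro mult_right_mono mult_left_mono) auto
    moreover have "W' t \<le> b t * (\<epsilon> t)\<^sup>2 * (norm (x t))\<^sup>2"
    proof -
      have "0 \<le> 7 / 8 * \<alpha> / p t * (norm (x' t))\<^sup>2" "0 \<le> b t / 2 * (norm (d t))\<^sup>2"
        using alpha_pos pos[OF that] b_nonneg[OF that] by auto
      then show ?thesis using W'_le[OF that] by linarith
    qed
    then have "(p t)\<^sup>2 * W' t \<le> (p t)\<^sup>2 * (b t * (\<epsilon> t)\<^sup>2 * (norm (x t))\<^sup>2)"
      by (intro mult_left_mono) auto
    \<comment> \<open>One factor \<open>p t * \<epsilon> t\<close> is set aside as the integrable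
      \<open>k\<close>; the other is bounded by \<open>K\<close>.\<close>
    moreover have "(p t)\<^sup>2 * (b t * (\<epsilon> t)\<^sup>2 * (norm (x t))\<^sup>2) = b t * (p t * \<epsilon> t) * (norm (x t))\<^sup>2 * k t"
      by (simp add: k_def power2_eq_square)
    moreover have "b t * (p t * \<epsilon> t) * (norm (x t))\<^sup>2 * k t \<le> B * K * X * k t"
      using T[OF that] pos[OF that] b_nonneg[OF that] X[OF that] B K k(2)[of t]
      by (intro mult_right_mono mult_mono) auto
    ultimately show ?thesis unfolding k2_def by simp
  qed
  obtain l where l: "((\<lambda>t. (p t)\<^sup>2 * W t) \<longlongrightarrow> l) at_top"
    using tendsto_of_derivative_le_integrable[OF k2 T_gt dp2W p2W'_le] W_ge(4) pos(2)
    by (metis less_imp_le mult_nonneg_nonneg zero_le_power2)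
  \<comment> \<open>Applied with \<open>p t * W t\<close> as the integrable function: one more
    factor \<open>t powr q\<close> turns it into the convergent quantity.\<close>
  have "l = 0"
    by (rule limit_zero_of_weighted_integrable[OF l _ cont_pW pW_nonneg int_pW, of q])
       (use q_range in \<open>auto simp: p_def power2_eq_square\<close>)
  with l have lim: "((\<lambda>t. (p t)\<^sup>2 * W t) \<longlongrightarrow> 0) at_top" by simp

  \<comment> \<open>Decay rates\<close>
  have sqrt_lim: "((\<lambda>t. sqrt (2 * ((p t)\<^sup>2 * W t))) \<longlongrightarrow> 0) at_top"
    using tendsto_real_sqrt[OF tendsto_mult_right_zero[OF lim, of 2]] by simp
  have ge_T: "\<forall>\<^sub>F t in at_top. t \<ge> T" by (rule eventually_ge_at_top)
  have lim_v: "((\<lambda>t. norm (x' t) * p t) \<longlongrightarrow> 0) at_top"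
  proof (rule tendsto_sandwich[OF _ _ tendsto_const sqrt_lim])
    show "\<forall>\<^sub>F t in at_top. 0 \<le> norm (x' t) * p t" by (simp add: p_def)
    show "\<forall>\<^sub>F t in at_top. norm (x' t) * p t \<le> sqrt (2 * ((p t)\<^sup>2 * W t))"
      using ge_T
    proof eventually_elim
      case (elim t)
      have "(p t)\<^sup>2 * ((norm (x' t))\<^sup>2 / 2) \<le> (p t)\<^sup>2 * W t"
        using W_ge(1)[of t] pos[OF elim] by (intro mult_left_mono) auto
      then show ?case by (intro real_le_rsqrt) (simp add: power_mult_distrib mult.commute)
    qed
  qed
  have lim_G: "((\<lambda>t. G t * (p t)\<^sup>2) \<longlongrightarrow> 0) at_top"
  proof (rule tendsto_sandwich[OF _ _ tendsto_const lim])
    show "\<forall>\<^sub>F t in at_top. 0 \<le> G t * (p t)\<^sup>2" using G_nonneg by simp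
    show "\<forall>\<^sub>F t in at_top. G t * (p t)\<^sup>2 \<le> (p t)\<^sup>2 * W t"
      using ge_T
    proof eventually_elim
      case (elim t)
      have "(p t)\<^sup>2 * G t \<le> (p t)\<^sup>2 * W t"
        using W_ge(2)[of t] pos[OF elim] by (intro mult_left_mono) auto
      then show ?case by (simp add: mult.commute)
    qed
  qed
  have lim_x: "((\<lambda>t. norm (x t) * (p t * sqrt (\<epsilon> t))) \<longlongrightarrow> 0) at_top"
  proof (rule tendsto_sandwich[OF _ _ tendsto_const sqrt_lim])
    show "\<forall>\<^sub>F t in at_top. 0 \<le> norm (x t) * (p t * sqrt (\<epsilon> t))"
      using ge_T by eventually_elim (simp add: p_nonneg pos(4))
    show "\<forall>\<^sub>F t in at_top. norm (x t) * (p t * sqrt (\<epsilon> t)) \<le> sqrt (2 * ((p t)\<^sup>2 * W t))"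
      using ge_T
    proof eventually_elim
      case (elim t)
      have "(p t)\<^sup>2 * (\<epsilon> t / 2 * (norm (x t))\<^sup>2) \<le> (p t)\<^sup>2 * W t"
        using W_ge(3)[of t] pos[OF elim] by (intro mult_left_mono) auto
      then show ?case using pos[OF elim]
        by (intro real_le_rsqrt) (simp add: power_mult_distrib mult_ac)
    qed
  qed
  \<comment> \<open>The lower bound on \<epsilon> makes it strictly positive, so that
    \<open>1 / (p t * sqrt (\<epsilon> t))\<close> is a genuine quotient for large
    \<open>t\<close>.\<close>
  have eps_pos: "0 < \<epsilon> t" if "t \<ge> T" for t
  proof -
    have "0 < q * (1 - q) / t\<^sup>2" using q_range pos[OF that] by simp
    then show ?thesis using T[OF that] by linarith
  qed
  have p2: "t powr (2 * q) = (p t)\<^sup>2" for t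
    unfolding p_def mult_2 powr_add power2_eq_square by (rule refl)
  have "p t \<noteq> 0" "p t * sqrt (\<epsilon> t) \<noteq> 0" if "t \<ge> T" for t
    using pos(3)[OF that] eps_pos[OF that] by auto
  then have nonzero: "\<forall>\<^sub>F t in at_top. p t \<noteq> 0" "\<forall>\<^sub>F t in at_top. (p t)\<^sup>2 \<noteq> 0"
    "\<forall>\<^sub>F t in at_top. p t * sqrt (\<epsilon> t) \<noteq> 0"
    unfolding eventually_at_top_linorder by (auto intro!: exI[of _ T])
  note smallo = smallo_from_tendsto_zero[OF lim_v nonzero(1)]
    smallo_from_tendsto_zero[OF lim_G nonzero(2)] smallo_from_tendsto_zero[OF lim_x nonzero(3)]
  show ?thesis
    using int_v int_G int_d2 int_d1 smallo
    unfolding inf p2 d_def G_def y_def b_def p_def by blast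
qed

end
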